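(* Let $(\sigma,\alpha)$ be a collection of hypermaps such that each cycle of $\alpha$ has length at most $3$. Then for any positive integer $m$, the number $m^{\kappa(\sigma,\alpha)}\cdot\chi(\sigma,\alpha;m)$ is the number of ways to color the vertices (cycles of $\sigma$) with $m$ colors in such a way that no two vertices of the same color are incident to the same cycle of $\alpha$; that is, such that any two distinct points on the same cycle of $\alpha$ belong to vertices of different colors (in particular there is no such coloring if two distinct points of some cycle of $\alpha$ lie on the same cycle of $\sigma$).
   Context: Permutations act on a finite set and are composed from right to left; $z(\pi)$ is the number of cycles of $\pi$ (fixed points included). A collection of hypermaps on $\{1,\ldots,n\}$ is an ordered pair $(\sigma,\alpha)$ of permutations of $\{1,\ldots,n\}$; $\kappa(\sigma,\alpha)$ is the number of orbits of the group generated by $\sigma$ and $\alpha$. A permutation $\beta$ is a refinement of $\alpha$ ($\beta\le\alpha$) if $\beta$ is obtained by replacing each cycle $\alpha_i$ of $\alpha$ by a permutation $\beta_i$ of the same set of $n_i$ points with $z(\beta_i)+z(\beta_i^{-1}\alpha_i)=n_i+1$. Refinement is a partial order; $\mu(\beta,\beta')$ denotes the Möbius function of the interval $[\beta,\beta']$ in this order, and $\mathrm{id}$ is the identity permutation. The characteristic polynomial of $(\sigma,\alpha)$ is $$\chi(\sigma,\alpha;t)=\sum_{\beta\le\alpha}\mu(\mathrm{id},\beta)\,t^{\kappa(\sigma,\beta)-\kappa(\sigma,\alpha)}.$$ *)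

theory Defs
  imports
    "HOL-Combinatorics.Orbits"
    "HOL-Algebra.Sym_Groups"
    "HOL-Algebra.Group_Action"
    "HOL-Computational_Algebra.Polynomial"
begin

text \<open>
  The cycles of \<open>\<pi>\<close> on an invariant set \<open>S\<close>, as sets of points. Fixed points of \<open>\<pi>\<close> in \<open>S\<close>
  contribute singleton cycles.
\<close>

definition cycles :: "('a \<Rightarrow> 'a) \<Rightarrow> 'a set \<Rightarrow> 'a set set" where
  "cycles \<pi> S = Orbits.orbit \<pi> ` S"

definition z :: "('a \<Rightarrow> 'a) \<Rightarrow> 'a set \<Rightarrow> nat" where
  "z \<pi> S = card (cycles \<pi> S)"

definition kappa :: "nat \<Rightarrow> (nat \<Rightarrow> nat) \<Rightarrow> (nat \<Rightarrow> nat) \<Rightarrow> nat" where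
  "kappa n \<sigma> \<alpha> =
     card (Group_Action.orbits (subgroup_generated (sym_group n) {\<sigma>, \<alpha>}) {1..n} (\<lambda>g. g))"

text \<open>
  For a cycle of \<open>\<alpha>\<close> with point set \<open>C\<close>, the cycle itself is \<open>perm_restrict \<alpha> C\<close>, and
  \<open>\<beta>\<^sub>i = perm_restrict \<beta> C\<close> is the permutation replacing it.
\<close>

definition refines :: "nat \<Rightarrow> (nat \<Rightarrow> nat) \<Rightarrow> (nat \<Rightarrow> nat) \<Rightarrow> bool" where
  "refines n \<beta> \<alpha> \<longleftrightarrow>
     \<beta> permutes {1..n} \<and>
     (\<forall>C \<in> cycles \<alpha> {1..n}.
        perm_restrict \<beta> C permutes C \<and>
        z (perm_restrict \<beta> C) C + z (inv_into UNIV (perm_restrict \<beta> C) \<circ> perm_restrict \<alpha> C) C = card C + 1)"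

definition refinement_order :: "nat \<Rightarrow> ((nat \<Rightarrow> nat) \<times> (nat \<Rightarrow> nat)) set" where
  "refinement_order n = {(\<beta>, \<alpha>). \<alpha> permutes {1..n} \<and> refines n \<beta> \<alpha>}"

text \<open>
  The Moebius function of a poset given by its order relation \<open>r\<close>. The value at \<open>(x, y)\<close> depends
  only on the interval from \<open>x\<close> to \<open>y\<close>. The guard on \<open>wf\<close> is there only to make the recursion
  terminate: it holds for every finite partial order, and for \<open>refinement_order n\<close>
  (lemma \<open>wf_refinement_order\<close> below).
\<close>

function mobius :: "('a \<times> 'a) set \<Rightarrow> 'a \<Rightarrow> 'a \<Rightarrow> int" where
  "mobius r x y =
     (if wf (r - Id) \<and> (x, y) \<in> r then
        if x = y then 1
        else - (\<Sum>w | (x, w) \<in> r \<and> (w, y) \<in> r \<and> w \<noteq> y. mobius r x w)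
      else 0)"
  by auto
termination
proof (relation "same_fst (\<lambda>r. wf (r - Id)) (\<lambda>r. inv_image (r - Id) snd)", goal_cases)
  case 1
  show ?case by (rule wf_same_fst) (rule wf_inv_image)
qed (simp add: same_fst_def)

declare mobius.simps [simp del]

definition characteristic_poly :: "nat \<Rightarrow> (nat \<Rightarrow> nat) \<Rightarrow> (nat \<Rightarrow> nat) \<Rightarrow> int poly" where
  \<comment> \<open>The subtraction never truncates: orbits for \<open>(\<sigma>, \<beta>)\<close> are contained in those for \<open>(\<sigma>, \<alpha>)\<close>.\<close>
  "characteristic_poly n \<sigma> \<alpha> =
     (\<Sum>\<beta> | refines n \<beta> \<alpha>.
        monom (mobius (refinement_order n) id \<beta>) (kappa n \<sigma> \<beta> - kappa n \<sigma> \<alpha>))"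

definition proper_colorings ::
    "nat \<Rightarrow> (nat \<Rightarrow> nat) \<Rightarrow> (nat \<Rightarrow> nat) \<Rightarrow> nat \<Rightarrow> (nat set \<Rightarrow> nat) set" where
  "proper_colorings n \<sigma> \<alpha> m =
     {c \<in> cycles \<sigma> {1..n} \<rightarrow>\<^sub>E {1..m}.
        \<forall>C \<in> cycles \<alpha> {1..n}. \<forall>x \<in> C. \<forall>y \<in> C. x \<noteq> y \<longrightarrow>
          c (Orbits.orbit \<sigma> x) \<noteq> c (Orbits.orbit \<sigma> y)}"

lemma wf_finite_partial_order:
  assumes "finite r" "antisym r" "trans r"
  shows "wf (r - Id)"
proof (rule finite_acyclic_wf)
  have "trans (r - Id)"
    using assms(2,3) by (auto simp: trans_def antisym_def)
  then show "acyclic (r - Id)"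
    by (simp add: acyclic_irrefl irrefl_def)
qed (use assms(1) in auto)

lemma orbit_perm_restrict_eq:
  assumes "perm_restrict f C permutes C" "x \<in> C"
  shows "Orbits.orbit (perm_restrict f C) x = Orbits.orbit f x \<and> Orbits.orbit f x \<subseteq> C"
proof -
  have step: "f y \<in> C \<and> perm_restrict f C y = f y" if "y \<in> C" for y
    using permutes_in_image[OF assms(1), of y] that by (simp add: perm_restrict_def)
  have A: "y \<in> C \<and> y \<in> Orbits.orbit (perm_restrict f C) x" if "y \<in> Orbits.orbit f x" for y
    using that
  proof induction
    case base
    then show ?case using step[OF assms(2)] Orbits.orbit.base[of "perm_restrict f C" x] by simp
  next
    case (step y)
    then show ?case
      using \<open>\<And>y. y \<in> C \<Longrightarrow> f y \<in> C \<and> perm_restrict f C y = f y\<close>[of y]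
        Orbits.orbit.step[of y "perm_restrict f C" x] by simp
  qed
  have B: "y \<in> C \<and> y \<in> Orbits.orbit f x" if "y \<in> Orbits.orbit (perm_restrict f C) x" for y
    using that
  proof induction
    case base
    then show ?case using step[OF assms(2)] Orbits.orbit.base[of f x] by simp
  next
    case (step y)
    then show ?case
      using \<open>\<And>y. y \<in> C \<Longrightarrow> f y \<in> C \<and> perm_restrict f C y = f y\<close>[of y]
        Orbits.orbit.step[of y f x] by simp
  qed
  show ?thesis using A B by blast
qed

lemma refines_orbit_less:
  assumes \<alpha>: "\<alpha> permutes {1..n}" and r: "refines n \<beta> \<alpha>" and ne: "\<beta> \<noteq> \<alpha>"
  shows "(\<Sum>x=1..n. card (Orbits.orbit \<beta> x)) < (\<Sum>x=1..n. card (Orbits.orbit \<alpha> x))"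
proof -
  have \<beta>: "\<beta> permutes {1..n}" using r by (simp add: refines_def)
  have perm\<alpha>: "permutation \<alpha>" using \<alpha> by (auto simp: permutation_permutes)
  have in_orb: "x \<in> Orbits.orbit \<alpha> x" for x
    by (rule permutation_self_in_orbit[OF perm\<alpha>])
  have fin: "finite (Orbits.orbit \<alpha> x)" for x
    by (rule finite_orbit[OF in_orb])
  have R: "perm_restrict \<beta> (Orbits.orbit \<alpha> x) permutes Orbits.orbit \<alpha> x"
      "z (perm_restrict \<beta> (Orbits.orbit \<alpha> x)) (Orbits.orbit \<alpha> x)
        + z (inv_into UNIV (perm_restrict \<beta> (Orbits.orbit \<alpha> x)) \<circ> perm_restrict \<alpha> (Orbits.orbit \<alpha> x))
            (Orbits.orbit \<alpha> x) = card (Orbits.orbit \<alpha> x) + 1" if "x \<in> {1..n}" for x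
    using r that unfolding refines_def cycles_def by blast+
  have sub: "Orbits.orbit \<beta> x \<subseteq> Orbits.orbit \<alpha> x" if "x \<in> {1..n}" for x
    using orbit_perm_restrict_eq[OF R(1)[OF that] in_orb] by blast
  have "\<exists>x\<in>{1..n}. \<beta> x \<noteq> \<alpha> x"
  proof (rule ccontr)
    assume "\<not> ?thesis"
    then have "\<beta> x = \<alpha> x" for x
      using \<alpha> \<beta> by (cases "x \<in> {1..n}") (auto simp: permutes_def)
    then show False using ne by blast
  qed
  then obtain a where a: "a \<in> {1..n}" "\<beta> a \<noteq> \<alpha> a" by blast
  define C where "C = Orbits.orbit \<alpha> a"
  define b where "b = perm_restrict \<beta> C"
  define g where "g = inv_into UNIV b \<circ> perm_restrict \<alpha> C"
  have aC: "a \<in> C" and finC: "finite C" unfolding C_def by (rule in_orb, rule fin)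
  have bC: "b permutes C" and zC: "z b C + z g C = card C + 1"
    using R[OF a(1)] by (simp_all add: C_def b_def g_def)
  have "Orbits.orbit \<beta> a \<noteq> C"
  proof
    assume eq: "Orbits.orbit \<beta> a = C"
    have "Orbits.orbit b a = C"
      using orbit_perm_restrict_eq[of \<beta> C a] bC aC eq by (simp add: b_def)
    then have "cyclic_on b C" using aC by (auto simp: cyclic_on_def)
    then have "cycles b C = {C}"
      using aC unfolding cyclic_on_alldef cycles_def by auto
    then have "z b C = 1" by (simp add: z_def)
    then have "card (Orbits.orbit g ` C) = card C" using zC by (simp add: z_def cycles_def)
    then have inj: "inj_on (Orbits.orbit g) C" by (simp add: eq_card_imp_inj_on finC)
    have "\<alpha> a \<in> C" unfolding C_def by (rule Orbits.orbit.base)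
    then have gaC: "g a \<in> C"
      using aC permutes_in_image[OF permutes_inv[OF bC]] by (simp add: g_def perm_restrict_def)
    have rp: "perm_restrict \<alpha> C permutes C"
    proof (rule bij_imp_permutes)
      have "perm_restrict \<alpha> C ` C \<subseteq> C"
        unfolding C_def perm_restrict_def by (auto intro: Orbits.orbit.step)
      moreover have "inj_on (perm_restrict \<alpha> C) C"
        using permutes_inj[OF \<alpha>] by (auto simp: inj_on_def perm_restrict_def)
      ultimately show "bij_betw (perm_restrict \<alpha> C) C C"
        using endo_inj_surj[OF finC] by (simp add: bij_betw_def)
    qed (simp add: perm_restrict_def)
    have "permutation g"
      unfolding g_def using rp permutes_inv[OF bC] finC
      by (auto simp: permutation_permutes intro!: permutes_compose exI[of _ C])
    then have "Orbits.orbit g (g a) = Orbits.orbit g a" by (rule permutation_orbit_step)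
    then have "g a = a" using inj gaC aC by (auto dest: inj_onD)
    then have "perm_restrict \<alpha> C a = b a"
      using permutes_inverses(1)[OF bC] by (metis comp_apply g_def)
    then show False using a(2) aC by (simp add: b_def perm_restrict_def)
  qed
  then have "card (Orbits.orbit \<beta> a) < card (Orbits.orbit \<alpha> a)"
    using sub[OF a(1)] fin by (intro psubset_card_mono) (auto simp: C_def)
  then show ?thesis
    using a(1) card_mono[OF fin sub] by (intro sum_strict_mono_ex1) auto
qed

lemma wf_refinement_order: "wf (refinement_order n - Id)"
proof (rule wf_subset)
  show "wf (inv_image less_than (\<lambda>\<beta>. \<Sum>x=1..n. card (Orbits.orbit \<beta> x)))"
    by simp
qed (use refines_orbit_less in \<open>force simp: refinement_order_def\<close>)

end

theory Submission
  imports Defs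
begin

text \<open>
  The number \<open>m ^ kappa n \<sigma> \<beta>\<close> counts the colorings of the points that are constant on the cycles of
  \<open>\<sigma>\<close> and of \<open>\<beta>\<close>. After exchanging summations, a coloring \<open>f\<close> constant on the cycles of \<open>\<sigma>\<close>
  contributes the sum of \<open>\<mu>(id, \<beta>)\<close> over all \<open>\<beta> \<le> \<alpha>\<close> that preserve \<open>f\<close>. Since the cycles of \<open>\<alpha>\<close> have
  length at most 3, no partition of a cycle is crossing, so these \<open>\<beta>\<close> form the interval below the
  permutation sending each point to the next point of the same color on its \<open>\<alpha>\<close>-cycle. Hence the
  contribution is 1 if that permutation is the identity, i.e. if \<open>f\<close> is proper, and 0 otherwise.
\<close>

section \<open>Colorings constant on the orbits of a group\<close>

text \<open>A function constant on the fibres of \<open>q\<close> factors uniquely through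
  \<open>q\<close>; the inverse map evaluates it at a chosen representative of each fibre. The lemma
  serves both for group orbits and for the cycles of \<open>\<sigma>\<close>.\<close>

lemma bij_betw_constant_on_fibres:
  "bij_betw (\<lambda>g. \<lambda>x\<in>S. g (q x)) (q ` S \<rightarrow>\<^sub>E M)
     {f \<in> S \<rightarrow>\<^sub>E M. \<forall>x\<in>S. \<forall>y\<in>S. q x = q y \<longrightarrow> f x = f y}"
proof (rule bij_betw_byWitness[where f' = "\<lambda>f. \<lambda>B\<in>q ` S. f (inv_into S q B)"])
  have inv: "inv_into S q B \<in> S" "q (inv_into S q B) = B" if "B \<in> q ` S" for B
    using that by (simp_all only: inv_into_into f_inv_into_f)
  show "\<forall>g\<in>q ` S \<rightarrow>\<^sub>E M. (\<lambda>B\<in>q ` S. (\<lambda>x\<in>S. g (q x)) (inv_into S q B)) = g"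
  proof
    fix g assume "g \<in> q ` S \<rightarrow>\<^sub>E M"
    then have "g \<in> extensional (q ` S)" by (simp add: PiE_iff)
    then show "(\<lambda>B\<in>q ` S. (\<lambda>x\<in>S. g (q x)) (inv_into S q B)) = g"
      by (intro extensionalityI[of _ "q ` S"] restrict_extensional)
        (simp_all only: restrict_apply inv if_True)
  qed
  show "\<forall>f\<in>{f \<in> S \<rightarrow>\<^sub>E M. \<forall>x\<in>S. \<forall>y\<in>S. q x = q y \<longrightarrow> f x = f y}.
      (\<lambda>x\<in>S. (\<lambda>B\<in>q ` S. f (inv_into S q B)) (q x)) = f"
  proof
    fix f assume f: "f \<in> {f \<in> S \<rightarrow>\<^sub>E M. \<forall>x\<in>S. \<forall>y\<in>S. q x = q y \<longrightarrow> f x = f y}"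
    then have ext: "f \<in> extensional S" by (simp add: PiE_iff)
    have "f (inv_into S q (q x)) = f x" if "x \<in> S" for x
      using f inv[of "q x"] that by blast
    then show "(\<lambda>x\<in>S. (\<lambda>B\<in>q ` S. f (inv_into S q B)) (q x)) = f"
      using ext by (intro extensionalityI[of _ S] restrict_extensional) simp_all
  qed
  show "(\<lambda>g. \<lambda>x\<in>S. g (q x)) ` (q ` S \<rightarrow>\<^sub>E M)
      \<subseteq> {f \<in> S \<rightarrow>\<^sub>E M. \<forall>x\<in>S. \<forall>y\<in>S. q x = q y \<longrightarrow> f x = f y}"
    by auto
  show "(\<lambda>f. \<lambda>B\<in>q ` S. f (inv_into S q B)) `
      {f \<in> S \<rightarrow>\<^sub>E M. \<forall>x\<in>S. \<forall>y\<in>S. q x = q y \<longrightarrow> f x = f y} \<subseteq> q ` S \<rightarrow>\<^sub>E M"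
  proof (intro image_subsetI, unfold restrict_PiE_iff, rule ballI)
    fix f B
    assume "f \<in> {f \<in> S \<rightarrow>\<^sub>E M. \<forall>x\<in>S. \<forall>y\<in>S. q x = q y \<longrightarrow> f x = f y}" and B: "B \<in> q ` S"
    then show "f (inv_into S q B) \<in> M" using inv(1)[OF B] by blast
  qed
qed

text \<open>Invariance under the two generators passes to the generated group, so an invariant
  coloring is a free choice of one color for each group orbit.\<close>

lemma card_invariant_colorings:
  assumes s: "\<sigma> permutes {1..n}" and b: "\<beta> permutes {1..n}"
  shows "card {f \<in> {1..n} \<rightarrow>\<^sub>E {1..m}. \<forall>x\<in>{1..n}. f (\<sigma> x) = f x \<and> f (\<beta> x) = f x}
           = m ^ kappa n \<sigma> \<beta>"
proof -
  let ?S = "{1..n}"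
  let ?H = "subgroup_generated (sym_group n) {\<sigma>, \<beta>}"
  define q where "q = Group_Action.orbit ?H (\<lambda>g. g)"
  interpret sym: group "sym_group n" by (rule sym_group_is_group)
  interpret H: group ?H by (rule sym.group_subgroup_generated)
  have carr: "carrier ?H = generate (sym_group n) {\<sigma>, \<beta>}"
    using s b by (auto simp: carrier_subgroup_generated sym_group_carrier intro!: arg_cong2[where f = generate])
  have perm: "g permutes ?S" if "g \<in> carrier ?H" for g
    using that sym.carrier_subgroup_generated_subset sym_group_carrier by blast
  have q: "y \<in> q x \<longleftrightarrow> (\<exists>g\<in>carrier ?H. y = g x)" for x y
    by (auto simp: q_def Group_Action.orbit_def)
  have self: "x \<in> q x" for x
    using H.one_closed by (auto simp: q sym_group_one intro: bexI[of _ id])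
  have q_eq: "q (g x) = q x" if g: "g \<in> carrier ?H" for g x
  proof (intro Set.set_eqI iffI)
    fix y assume "y \<in> q (g x)"
    then obtain h where "h \<in> carrier ?H" "y = (h \<circ> g) x" by (auto simp: q)
    then show "y \<in> q x" using g H.m_closed[of h g] by (auto simp: q sym_group_mult intro!: bexI[of _ "h \<circ> g"])
  next
    fix y assume "y \<in> q x"
    then obtain h where h: "h \<in> carrier ?H" "y = h x" by (auto simp: q)
    have i: "inv' g \<in> carrier ?H"
      using H.inv_closed[OF g] g sym.carrier_subgroup_generated_subset[of "{\<sigma>, \<beta>}"] by auto
    have "y = (h \<circ> inv' g) (g x)"
      using h(2) permutes_inverses(2)[OF perm[OF g]] by simp
    then show "y \<in> q (g x)" using H.m_closed[OF h(1) i] unfolding q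
      by (intro bexI[of _ "h \<circ> inv' g"]) (simp_all add: sym_group_mult)
  qed
  \<comment> \<open>Induction over the generated group. Membership in \<open>?S\<close> is carried
    along and \<open>x\<close> stays arbitrary: for a product the outer factor is applied at the
    image under the inner one, and for an inverse the colors of \<open>inv' h x\<close> and of its
    image \<open>x\<close> under \<open>h\<close> are compared.\<close>
  have inv: "g x \<in> ?S \<and> f (g x) = f x"
    if f: "\<forall>x\<in>?S. f (\<sigma> x) = f x \<and> f (\<beta> x) = f x" and g: "g \<in> carrier ?H" and x: "x \<in> ?S"
    for f :: "nat \<Rightarrow> nat" and g x
    using g x unfolding carr
  proof (induction arbitrary: x)
    case one
    then show ?case by (simp add: sym_group_one)
  next
    case (incl h)
    then have "h permutes ?S" using s b by auto
    then show ?case using incl f permutes_in_image by (metis insertE singletonD)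
  next
    case (inv h)
    then have h: "h permutes ?S" using s b by auto
    have y: "inv' h x \<in> ?S" using permutes_in_image[OF permutes_inv[OF h]] inv by simp
    then have "f (h (inv' h x)) = f (inv' h x)" using inv(1) f by auto
    then show ?case
      using y h permutes_inverses(1)[OF h] by (simp add: sym_group_carrier)
  next
    case (eng h1 h2)
    then show ?case by (simp add: sym_group_mult)
  qed
  have "{f \<in> ?S \<rightarrow>\<^sub>E {1..m}. \<forall>x\<in>?S. f (\<sigma> x) = f x \<and> f (\<beta> x) = f x}
      = {f \<in> ?S \<rightarrow>\<^sub>E {1..m}. \<forall>x\<in>?S. \<forall>y\<in>?S. q x = q y \<longrightarrow> f x = f y}"
  proof (intro Collect_cong conj_cong refl iffI ballI impI)
    fix f :: "nat \<Rightarrow> nat" and x y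
    assume "\<forall>x\<in>?S. f (\<sigma> x) = f x \<and> f (\<beta> x) = f x" "x \<in> ?S" "q x = q y"
    then show "f x = f y" using inv self[of y] unfolding \<open>q x = q y\<close>[symmetric] q by metis
  next
    fix f :: "nat \<Rightarrow> nat" and x
    assume f: "\<forall>x\<in>?S. \<forall>y\<in>?S. q x = q y \<longrightarrow> f x = f y" and x: "x \<in> ?S"
    have "\<sigma> \<in> carrier ?H" "\<beta> \<in> carrier ?H" unfolding carr by (auto intro: generate.incl)
    then show "f (\<sigma> x) = f x \<and> f (\<beta> x) = f x"
      using f x q_eq permutes_in_image[OF s] permutes_in_image[OF b] by metis
  qed
  also have "card \<dots> = card (q ` ?S \<rightarrow>\<^sub>E {1..m})"
    by (rule bij_betw_same_card[symmetric, OF bij_betw_constant_on_fibres])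
  also have "\<dots> = m ^ card (q ` ?S)" by (simp add: card_funcsetE)
  also have "q ` ?S = orbits ?H ?S (\<lambda>g. g)" by (auto simp: orbits_def q_def)
  finally show ?thesis by (simp add: kappa_def)
qed

section \<open>Cycle counts on at most three points\<close>

text \<open>If none of the first three iterates returned to \<open>x\<close>, injectivity would make
  all four listed points distinct, too many for \<open>C\<close>.\<close>

lemma inj_periodic_of_card_le_3:
  assumes inj: "inj f" and C: "finite C" "card C \<le> 3" and mem: "{x, f x, f (f x), f (f (f x))} \<subseteq> C"
  shows "f x = x \<or> f (f x) = x \<or> f (f (f x)) = x"
proof (rule ccontr)
  assume "\<not> ?thesis"
  then have "card {x, f x, f (f x), f (f (f x))} = 4"
    using inj by (auto simp: inj_eq card_insert_if)
  then show False using card_mono[OF C(1) mem] C(2) by simp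
qed

lemma orbit_of_periodic_3:
  assumes "f x = x \<or> f (f x) = x \<or> f (f (f x)) = x"
  shows "Orbits.orbit f x = {x, f x, f (f x)}"
proof
  show "Orbits.orbit f x \<subseteq> {x, f x, f (f x)}"
  proof
    fix y assume "y \<in> Orbits.orbit f x"
    then show "y \<in> {x, f x, f (f x)}"
      by induction (use assms in auto)
  qed
  \<comment> \<open>An orbit is generated from \<open>f x\<close> onwards; \<open>x\<close> belongs
    to it as the iterate that returns, at the latest the third.\<close>
  have "f x \<in> Orbits.orbit f x" "f (f x) \<in> Orbits.orbit f x" "f (f (f x)) \<in> Orbits.orbit f x"
    by (auto intro: Orbits.orbit.intros)
  then show "{x, f x, f (f x)} \<subseteq> Orbits.orbit f x" using assms by auto
qed

lemma permutes_periodic_3: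
  assumes f: "f permutes C" and C: "finite C" "card C \<le> 3"
  shows "f x = x \<or> f (f x) = x \<or> f (f (f x)) = x"
proof (cases "x \<in> C")
  case True
  then show ?thesis
    using inj_periodic_of_card_le_3[OF permutes_inj[OF f] C, of x] permutes_in_image[OF f] by simp
next
  case False
  then show ?thesis using f by (simp add: permutes_not_in)
qed

text \<open>One set expression covers cycles of length 1, 2 and 3, with repetitions, so
  \<open>z\<close> can be evaluated by simplification once the values of \<open>f\<close> are
  known.\<close>

lemma z_of_card_le_3:
  assumes "f permutes C" "finite C" "card C \<le> 3"
  shows "z f C = card ((\<lambda>x. {x, f x, f (f x)}) ` C)"
proof -
  have "Orbits.orbit f x = {x, f x, f (f x)}" for x
    by (rule orbit_of_periodic_3) (rule permutes_periodic_3[OF assms])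
  then show ?thesis by (simp add: z_def cycles_def)
qed

lemma permutes_insert3:
  assumes ne: "p \<noteq> q" "p \<noteq> r" "q \<noteq> r" and f: "f permutes {p, q, r}"
  shows "(f p, f q, f r) \<in> {(p,q,r), (p,r,q), (q,p,r), (q,r,p), (r,p,q), (r,q,p)}"
proof -
  have "f x \<in> {p, q, r}" if "x \<in> {p, q, r}" for x
    using permutes_in_image[OF f] that by blast
  then have "f p = p \<or> f p = q \<or> f p = r" "f q = p \<or> f q = q \<or> f q = r" "f r = p \<or> f r = q \<or> f r = r"
    by blast+
  moreover have "f p \<noteq> f q" "f p \<noteq> f r" "f q \<noteq> f r"
    using ne inj_eq[OF permutes_inj[OF f]] by blast+
  ultimately show ?thesis by (elim disjE) simp_all
qed

text \<open>Fixed points tell the three cycle types apart: the identity fixes everything, a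
  transposition exactly one point, a 3-cycle none. Two fixed points force the third.\<close>

lemma z_insert3:
  assumes ne: "p \<noteq> q" "p \<noteq> r" "q \<noteq> r" and f: "f permutes {p, q, r}"
  shows "z f {p, q, r} = (if f p = p \<and> f q = q then 3
    else if f p = p \<or> f q = q \<or> f r = r then 2 else 1)"
proof -
  have "card {p, q, r} \<le> 3" by (simp add: card_insert_if)
  then have "z f {p, q, r} = card ((\<lambda>x. {x, f x, f (f x)}) ` {p, q, r})"
    by (intro z_of_card_le_3[OF f]) auto
  note z = this
  consider "f p = p" "f q = q" "f r = r" | "f p = p" "f q = r" "f r = q"
    | "f p = q" "f q = p" "f r = r" | "f p = q" "f q = r" "f r = p"
    | "f p = r" "f q = p" "f r = q" | "f p = r" "f q = q" "f r = p"
    using permutes_insert3[OF ne f] by auto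
  then show ?thesis
    unfolding z using ne ne[symmetric]
    by cases (simp_all add: card_insert_if insert_commute doubleton_eq_iff)
qed

lemma permutes_insert2:
  assumes "p \<noteq> q" and f: "f permutes {p, q}"
  shows "f p = p \<and> f q = q \<or> f p = q \<and> f q = p"
proof -
  have "f p = p \<or> f p = q" "f q = p \<or> f q = q"
    using permutes_in_image[OF f] by blast+
  moreover have "f p \<noteq> f q" using assms(1) inj_eq[OF permutes_inj[OF f]] by blast
  ultimately show ?thesis by (elim disjE) simp_all
qed

lemma z_insert2:
  assumes ne: "p \<noteq> q" and f: "f permutes {p, q}"
  shows "z f {p, q} = (if f p = p then 2 else 1)"
proof -
  have "z f {p, q} = card ((\<lambda>x. {x, f x, f (f x)}) ` {p, q})"
    using ne by (intro z_of_card_le_3[OF f]) auto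
  moreover note permutes_insert2[OF ne f]
  ultimately show ?thesis using ne by (auto simp: insert_commute)
qed

lemma z_singleton: "z f {p} = 1"
  by (simp add: z_def cycles_def)

text \<open>A finite check. One or two points allow no violation of either side. On a 3-cycle the
  sum must be 4: the identity gives 3+1, a transposition 2+2, the cycle itself 1+3, and only the
  inverse cycle fails with 1+1.\<close>

lemma noncrossing_iff_of_card_le_3:
  assumes a: "a permutes C" and b: "b permutes C"
    and C: "p \<in> C" "Orbits.orbit a p = C" "card C \<le> 3" and fin: "finite C"
  shows "z b C + z (inv_into UNIV b \<circ> a) C = card C + 1 \<longleftrightarrow>
    (\<forall>x\<in>C. b x = x \<or> b x = a x \<or> b x = a (a x) \<and> b (b x) = x)"
proof -
  let ?d = "inv_into UNIV b \<circ> a"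
  have d: "?d permutes C" by (intro permutes_compose a permutes_inv b)
  \<comment> \<open>The formulas for \<open>z\<close> only test for fixed points, and
    \<open>?d\<close> fixes \<open>x\<close> exactly when \<open>b x = a x\<close>, so
    \<open>?d\<close> need not be computed in the cases.\<close>
  have d_iff: "?d x = y \<longleftrightarrow> b y = a x" for x y
    using permutes_inv_eq[OF b] by auto
  have per: "a p = p \<or> a (a p) = p \<or> a (a (a p)) = p"
    by (rule permutes_periodic_3[OF a fin C(3)])
  have Ceq: "C = {p, a p, a (a p)}"
    using orbit_of_periodic_3[OF per] C(2) by simp
  consider (1) "a p = p" | (2) "a p \<noteq> p" "a (a p) = p"
    | (3) "a p \<noteq> p" "a (a p) \<noteq> p" "a (a (a p)) = p"
    using per by blast
  then show ?thesis
  proof cases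
    case 1
    then have "C = {p}" using Ceq by auto
    then show ?thesis using permutes_in_image[OF b, of p] by (simp add: z_singleton)
  next
    case 2
    define q where "q = a p"
    have q: "p \<noteq> q" "a p = q" "a q = p" "C = {p, q}" using 2 Ceq by (auto simp: q_def)
    consider "b p = p" "b q = q" | "b p = q" "b q = p"
      using permutes_insert2[OF q(1) b[unfolded q(4)]] by blast
    then show ?thesis
      using q(1) q(1)[symmetric]
      unfolding q(4) z_insert2[OF q(1) b[unfolded q(4)]] z_insert2[OF q(1) d[unfolded q(4)]] d_iff
      by cases (simp_all add: q(2,3))
  next
    case 3
    define q r where "q = a p" and "r = a (a p)"
    have "q \<noteq> r" using 3 permutes_inj[OF a] by (auto simp: q_def r_def inj_eq)
    then have ne: "p \<noteq> q" "p \<noteq> r" "q \<noteq> r" and q: "a p = q" "a q = r" "a r = p" "C = {p, q, r}"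
      using 3 Ceq by (auto simp: q_def r_def)
    consider "b p = p" "b q = q" "b r = r" | "b p = p" "b q = r" "b r = q"
      | "b p = q" "b q = p" "b r = r" | "b p = q" "b q = r" "b r = p"
      | "b p = r" "b q = p" "b r = q" | "b p = r" "b q = q" "b r = p"
      using permutes_insert3[OF ne b[unfolded q(4)]] by auto
    then show ?thesis
      using ne ne[symmetric]
      unfolding q(4) z_insert3[OF ne b[unfolded q(4)]] z_insert3[OF ne d[unfolded q(4)]] d_iff
      by cases (simp_all add: q(1-3))
  qed
qed

section \<open>Refinement as a pointwise condition\<close>

lemma perm_restrict_permutes:
  assumes "inj f" "finite C" "f ` C \<subseteq> C"
  shows "perm_restrict f C permutes C"
proof (rule bij_imp_permutes)
  have "bij_betw f C C"
    using assms endo_inj_surj[of C f] by (auto simp: bij_betw_def intro: inj_on_subset)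
  then show "bij_betw (perm_restrict f C) C C"
    by (simp add: perm_restrict_def cong: bij_betw_cong)
qed (simp add: perm_restrict_def)

lemma cycles_perm:
  assumes f: "f permutes S" and S: "finite S" and C: "C \<in> cycles f S"
  shows "C \<subseteq> S" "finite C" "C \<noteq> {}" "perm_restrict f C permutes C"
    and "\<And>x. x \<in> C \<Longrightarrow> Orbits.orbit f x = C" "\<And>x. x \<in> C \<Longrightarrow> f x \<in> C"
proof -
  obtain p where p: "p \<in> S" "C = Orbits.orbit f p" using C by (auto simp: cycles_def)
  have cyc: "cyclic_on f C" unfolding p(2) by (rule cyclic_on_orbit[OF f S])
  show "C \<subseteq> S" unfolding p(2) by (rule permutes_orbit_subset[OF f p(1)])
  show fin: "finite C" by (rule finite_cyclic_on[OF cyc])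
  show "C \<noteq> {}" and orb: "\<And>x. x \<in> C \<Longrightarrow> Orbits.orbit f x = C"
    using cyc by (auto simp: cyclic_on_alldef)
  show closed: "\<And>x. x \<in> C \<Longrightarrow> f x \<in> C" by (rule cyclic_on_inI[OF cyc])
  show "perm_restrict f C permutes C"
    by (rule perm_restrict_permutes) (use permutes_inj[OF f] fin closed in auto)
qed

text \<open>On a cycle \<open>C\<close> the identity has \<open>card C\<close> cycles, and the
  quotient is the cycle itself, which counts 1. Hence \<open>id\<close> is the least element of the
  order, where the Moebius sums start.\<close>

lemma refines_id:
  assumes a: "\<alpha> permutes {1..n}"
  shows "refines n id \<alpha>"
  unfolding refines_def
proof (intro conjI ballI)
  show "id permutes {1..n}" by (rule permutes_id)
  fix C assume C: "C \<in> cycles \<alpha> {1..n}"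
  note cyc = cycles_perm[OF a finite_atLeastAtMost C]
  have restr: "perm_restrict id C = id" by (auto simp: perm_restrict_def)
  show "perm_restrict id C permutes C" by (simp add: restr permutes_id)
  have "Orbits.orbit (id :: nat \<Rightarrow> nat) x = {x}" for x by (simp add: orbit_eq_singleton_iff)
  then have "z id C = card C" by (simp add: z_def cycles_def card_image)
  moreover have "cycles (perm_restrict \<alpha> C) C = {C}"
    using orbit_perm_restrict_eq[OF cyc(4)] cyc(3,5) by (auto simp: cycles_def)
  ultimately show "z (perm_restrict id C) C
      + z (inv_into UNIV (perm_restrict id C) \<circ> perm_restrict \<alpha> C) C = card C + 1"
    by (simp add: restr z_def)
qed

text \<open>On a 3-cycle every permutation of its points is a refinement except the inverse cycle;
  the last clause excludes exactly that one.\<close>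

definition short_refines :: "('a \<Rightarrow> 'a) \<Rightarrow> ('a \<Rightarrow> 'a) \<Rightarrow> bool" where
  "short_refines \<beta> \<alpha> \<longleftrightarrow> (\<forall>x. \<beta> x = x \<or> \<beta> x = \<alpha> x \<or> \<beta> x = \<alpha> (\<alpha> x) \<and> \<beta> (\<beta> x) = x)"

text \<open>A pointwise form of the length bound, over all points of the type: case distinctions on
  iterates then replace arguments about orbits.\<close>

definition cycles_le_3 :: "('a \<Rightarrow> 'a) \<Rightarrow> bool" where
  "cycles_le_3 \<alpha> \<longleftrightarrow> (\<forall>x. \<alpha> x = x \<or> \<alpha> (\<alpha> x) = x \<or> \<alpha> (\<alpha> (\<alpha> x)) = x)"

lemma cycles_le_3I:
  assumes a: "\<alpha> permutes S" "finite S" and card: "\<And>C. C \<in> cycles \<alpha> S \<Longrightarrow> card C \<le> 3"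
  shows "cycles_le_3 \<alpha>"
  unfolding cycles_le_3_def
proof
  fix x
  show "\<alpha> x = x \<or> \<alpha> (\<alpha> x) = x \<or> \<alpha> (\<alpha> (\<alpha> x)) = x"
  proof (cases "x \<in> S")
    case True
    then have C: "Orbits.orbit \<alpha> x \<in> cycles \<alpha> S" by (simp add: cycles_def)
    have "permutation \<alpha>" using a by (auto simp: permutation_permutes)
    then have "x \<in> Orbits.orbit \<alpha> x" by (rule permutation_self_in_orbit)
    then show ?thesis
      using cycles_perm(2,6)[OF a C] card[OF C]
      by (intro inj_periodic_of_card_le_3[OF permutes_inj[OF a(1)]]) auto
  next
    case False
    then show ?thesis using a(1) by (simp add: permutes_not_in)
  qed
qed

lemma orbit_cycles_le_3: "cycles_le_3 \<alpha> \<Longrightarrow> Orbits.orbit \<alpha> x = {x, \<alpha> x, \<alpha> (\<alpha> x)}"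
  by (intro orbit_of_periodic_3) (simp add: cycles_le_3_def)

text \<open>Cycle by cycle this is \<open>noncrossing_iff_of_card_le_3\<close>. Points outside
  \<open>{1..n}\<close> are fixed by \<open>\<beta>\<close> and meet the first alternative of
  \<open>short_refines\<close>.\<close>

lemma refines_iff:
  assumes a: "\<alpha> permutes {1..n}" and le3: "cycles_le_3 \<alpha>"
  shows "refines n \<beta> \<alpha> \<longleftrightarrow> \<beta> permutes {1..n} \<and> short_refines \<beta> \<alpha>"
proof (cases "\<beta> permutes {1..n}")
  case b: True
  let ?P = "\<lambda>x. \<beta> x = x \<or> \<beta> x = \<alpha> x \<or> \<beta> x = \<alpha> (\<alpha> x) \<and> \<beta> (\<beta> x) = x"
  have cycle: "perm_restrict \<beta> C permutes C
      \<and> z (perm_restrict \<beta> C) C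
          + z (inv_into UNIV (perm_restrict \<beta> C) \<circ> perm_restrict \<alpha> C) C = card C + 1
    \<longleftrightarrow> (\<forall>x\<in>C. ?P x)" (is "?perm \<and> ?z \<longleftrightarrow> ?all")
    if C: "C \<in> cycles \<alpha> {1..n}" for C
  proof -
    note cyc = cycles_perm[OF a finite_atLeastAtMost C]
    obtain p where p: "p \<in> C" using cyc(3) by blast
    have "card C \<le> 3"
      using orbit_cycles_le_3[OF le3, of p] cyc(5)[OF p] by (auto simp: card_insert_if)
    moreover have "Orbits.orbit (perm_restrict \<alpha> C) p = C"
      using orbit_perm_restrict_eq[OF cyc(4) p] cyc(5)[OF p] by simp
    ultimately have z: "?z \<longleftrightarrow> (\<forall>x\<in>C. perm_restrict \<beta> C x = x
        \<or> perm_restrict \<beta> C x = perm_restrict \<alpha> C x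
        \<or> perm_restrict \<beta> C x = perm_restrict \<alpha> C (perm_restrict \<alpha> C x)
          \<and> perm_restrict \<beta> C (perm_restrict \<beta> C x) = x)" if ?perm
      using noncrossing_iff_of_card_le_3[OF cyc(4) that p] cyc(2) by blast
    have z': "?z \<longleftrightarrow> ?all" if ?perm
    proof -
      have "\<beta> x \<in> C" if "x \<in> C" for x
        using permutes_in_image[OF \<open>?perm\<close>, of x] that by (simp add: perm_restrict_def)
      then show ?thesis
        unfolding z[OF that] using cyc(6) by (simp add: perm_restrict_def)
    qed
    \<comment> \<open>Each alternative in \<open>?P x\<close> keeps \<open>\<beta> x\<close> on the
      \<open>\<alpha>\<close>-cycle of \<open>x\<close>, so \<open>\<beta>\<close> maps
      \<open>C\<close> into itself.\<close>
    have ?perm if ?all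
    proof (rule perm_restrict_permutes[OF permutes_inj[OF b] cyc(2)])
      show "\<beta> ` C \<subseteq> C"
      proof
        fix y assume "y \<in> \<beta> ` C"
        then obtain x where "x \<in> C" "y = \<beta> x" by blast
        then show "y \<in> C" using that cyc(6) by metis
      qed
    qed
    with z' show ?thesis by blast
  qed
  have "(\<forall>C\<in>cycles \<alpha> {1..n}. \<forall>x\<in>C. ?P x) \<longleftrightarrow> (\<forall>x. ?P x)"
  proof (intro iffI allI ballI)
    fix x assume all: "\<forall>C\<in>cycles \<alpha> {1..n}. \<forall>x\<in>C. ?P x"
    show "?P x"
    proof (cases "x \<in> {1..n}")
      case True
      then have "Orbits.orbit \<alpha> x \<in> cycles \<alpha> {1..n}" by (simp add: cycles_def)
      moreover have "x \<in> Orbits.orbit \<alpha> x" by (simp add: orbit_cycles_le_3[OF le3])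
      ultimately show ?thesis using all by blast
    next
      case False
      then show ?thesis using permutes_not_in[OF b] by simp
    qed
  qed blast
  then show ?thesis
    using b cycle unfolding refines_def short_refines_def by simp
qed (simp add: refines_def)

section \<open>The permutation induced on the color classes\<close>

text \<open>When cycles have length at most 3, the candidates \<open>\<alpha> x\<close>,
  \<open>\<alpha> (\<alpha> x)\<close>, \<open>x\<close> exhaust the cycle in cyclic order, so this
  is the first-return map of \<open>\<alpha>\<close> to the color class of \<open>x\<close>. On a
  2-cycle the second test always succeeds and yields \<open>x\<close>.\<close>

definition first_return :: "('a \<Rightarrow> 'a) \<Rightarrow> ('a \<Rightarrow> 'b) \<Rightarrow> 'a \<Rightarrow> 'a" where
  "first_return \<alpha> f x =
     (if f (\<alpha> x) = f x then \<alpha> x else if f (\<alpha> (\<alpha> x)) = f x then \<alpha> (\<alpha> x) else x)"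

text \<open>A self-map of a finite set is bijective once it is onto, and \<open>y\<close> is the
  image of the preceding point of its color on the cycle, which is \<open>y\<close>,
  \<open>\<alpha> y\<close> or \<open>\<alpha> (\<alpha> y)\<close>.\<close>

lemma first_return_permutes:
  assumes a: "\<alpha> permutes S" and S: "finite S" and le3: "cycles_le_3 \<alpha>"
  shows "first_return \<alpha> f permutes S"
proof (rule bij_imp_permutes)
  let ?g = "first_return \<alpha> f"
  have surj: "\<exists>x\<in>S. y = ?g x" if y: "y \<in> S" for y
  proof -
    have mem: "\<alpha> y \<in> S" "\<alpha> (\<alpha> y) \<in> S" using y permutes_in_image[OF a] by auto
    consider "\<alpha> y = y" | "\<alpha> (\<alpha> y) = y" | "\<alpha> (\<alpha> (\<alpha> y)) = y"
      using le3 unfolding cycles_le_3_def by blast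
    then have "y = ?g y \<or> y = ?g (\<alpha> y) \<or> y = ?g (\<alpha> (\<alpha> y))"
      by cases (auto simp: first_return_def)
    then show ?thesis using y mem by blast
  qed
  have "S \<subseteq> ?g ` S" using surj by blast
  moreover have "?g ` S \<subseteq> S" using permutes_in_image[OF a] by (auto simp: first_return_def)
  ultimately show "bij_betw ?g S S"
    using finite_surj_inj[OF S] by (auto simp: bij_betw_def)
  show "?g x = x" if "x \<notin> S" for x
    using permutes_not_in[OF a that] by (simp add: first_return_def)
qed

lemma cycles_le_3_first_return:
  assumes "cycles_le_3 \<alpha>" shows "cycles_le_3 (first_return \<alpha> f)"
  unfolding cycles_le_3_def
proof
  fix x
  have "\<alpha> x = x \<or> \<alpha> (\<alpha> x) = x \<or> \<alpha> (\<alpha> (\<alpha> x)) = x"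
    using assms by (simp add: cycles_le_3_def)
  then show "first_return \<alpha> f x = x \<or> first_return \<alpha> f (first_return \<alpha> f x) = x
    \<or> first_return \<alpha> f (first_return \<alpha> f (first_return \<alpha> f x)) = x"
    by (auto simp: first_return_def)
qed

text \<open>This makes the color-preserving refinements of \<open>\<alpha>\<close> an interval. Once
  \<open>\<beta>\<close> preserves \<open>f\<close>, the conditions for \<open>g\<close> and for
  \<open>\<alpha>\<close> agree at \<open>x\<close>, except on a 3-cycle where
  \<open>\<alpha> (\<alpha> x)\<close> has the color of \<open>x\<close> and
  \<open>\<alpha> x\<close> has not. There \<open>g\<close> swaps \<open>x\<close> and
  \<open>\<alpha> (\<alpha> x)\<close>, and only the condition for \<open>\<alpha>\<close> asks
  explicitly that \<open>\<beta>\<close> swap them back.\<close>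

lemma short_refines_first_return_iff:
  assumes b: "inj \<beta>" and le3: "cycles_le_3 \<alpha>"
  shows "short_refines \<beta> (first_return \<alpha> f) \<longleftrightarrow> short_refines \<beta> \<alpha> \<and> (\<forall>x. f (\<beta> x) = f x)"
proof -
  define g where "g = first_return \<alpha> f"
  have g: "g x = (if f (\<alpha> x) = f x then \<alpha> x else if f (\<alpha> (\<alpha> x)) = f x then \<alpha> (\<alpha> x) else x)" for x
    by (simp add: g_def first_return_def)
  have f_g: "f (g x) = f x" for x by (simp add: g)
  have le: "\<alpha> x = x \<or> \<alpha> (\<alpha> x) = x \<or> \<alpha> (\<alpha> (\<alpha> x)) = x" for x
    using le3 by (simp add: cycles_le_3_def)
  \<comment> \<open>The premise \<open>ret\<close> is the missing return in the exceptional case; it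
    is derived separately for each direction.\<close>
  have eq: "(\<beta> x = x \<or> \<beta> x = g x \<or> \<beta> x = g (g x) \<and> \<beta> (\<beta> x) = x)
      \<longleftrightarrow> (\<beta> x = x \<or> \<beta> x = \<alpha> x \<or> \<beta> x = \<alpha> (\<alpha> x) \<and> \<beta> (\<beta> x) = x)"
    if f: "f (\<beta> x) = f x"
      and ret: "\<alpha> (\<alpha> (\<alpha> x)) = x \<Longrightarrow> f (\<alpha> (\<alpha> x)) = f x
        \<Longrightarrow> \<beta> x = \<alpha> (\<alpha> x) \<Longrightarrow> f (\<alpha> x) \<noteq> f x \<Longrightarrow> \<beta> (\<alpha> (\<alpha> x)) = x"
    for x
  proof -
    obtain y w where y: "\<alpha> x = y" and w: "\<alpha> y = w" by blast
    have gx: "g x = (if f y = f x then y else if f w = f x then w else x)"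
      by (simp add: g y w)
    consider (1) "y = x" | (2) "w = x" | (3) "\<alpha> w = x" using le[of x] y w by auto
    then show ?thesis
    proof cases
      case 1
      then have "w = x" using y w by simp
      then show ?thesis using 1 gx y w by simp
    next
      case 2
      have gy: "g y = (if f x = f y then x else y)"
        using w y 2 by (simp add: g)
      have "(\<beta> x = x \<or> \<beta> x = g x \<or> \<beta> x = g (g x) \<and> \<beta> (\<beta> x) = x) \<longleftrightarrow> \<beta> x = x \<or> \<beta> x = y"
        using f by (cases "f y = f x") (auto simp: gx gy 2)
      then show ?thesis unfolding y w 2 by auto
    next
      case 3
      have gy: "g y = (if f w = f y then w else if f x = f y then x else y)"
        using w 3 by (simp add: g)
      have gw: "g w = (if f x = f w then x else if f y = f w then y else w)"
        using 3 y by (simp add: g)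
      have r: "f w = f x \<Longrightarrow> \<beta> x = w \<Longrightarrow> f y \<noteq> f x \<Longrightarrow> \<beta> w = x"
        using ret 3 by (simp add: y w)
      have "(\<beta> x = x \<or> \<beta> x = g x \<or> \<beta> x = g (g x) \<and> \<beta> (\<beta> x) = x)
          \<longleftrightarrow> (\<beta> x = x \<or> \<beta> x = y \<or> \<beta> x = w \<and> \<beta> (\<beta> x) = x)"
      proof (cases "f y = f x")
        case True
        then show ?thesis using f by (cases "f w = f x") (auto simp: gx gy)
      next
        case False
        then show ?thesis using f r by (cases "f w = f x") (auto simp: gx gw)
      qed
      then show ?thesis unfolding y w .
    qed
  qed
  show ?thesis
    unfolding g_def[symmetric]
  proof
    assume H: "short_refines \<beta> g"
    have f: "f (\<beta> x) = f x" for x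
      using H f_g unfolding short_refines_def by metis
    \<comment> \<open>Since \<open>g\<close> swaps \<open>x\<close> and \<open>w\<close>, the image
      of \<open>w\<close> under \<open>\<beta>\<close> is \<open>w\<close> or \<open>x\<close>; as
      \<open>\<beta> x = w\<close>, injectivity leaves \<open>x\<close>.\<close>
    have ret: "\<beta> (\<alpha> (\<alpha> x)) = x"
      if "\<alpha> (\<alpha> (\<alpha> x)) = x" "f (\<alpha> (\<alpha> x)) = f x" "\<beta> x = \<alpha> (\<alpha> x)" "f (\<alpha> x) \<noteq> f x" for x
    proof -
      define w where "w = \<alpha> (\<alpha> x)"
      have w: "g w = x" "g x = w" "\<beta> x = w"
        using that by (simp_all add: g w_def)
      have "\<beta> w = w \<or> \<beta> w = g w \<or> \<beta> w = g (g w) \<and> \<beta> (\<beta> w) = w"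
        using H unfolding short_refines_def by blast
      then have "\<beta> w = x" unfolding w using w(3) inj_eq[OF b, of x w] by metis
      then show ?thesis by (simp add: w_def)
    qed
    show "short_refines \<beta> \<alpha> \<and> (\<forall>x. f (\<beta> x) = f x)"
      using H f eq[OF f ret] unfolding short_refines_def by blast
  next
    assume H: "short_refines \<beta> \<alpha> \<and> (\<forall>x. f (\<beta> x) = f x)"
    \<comment> \<open>Here the return comes from the last clause of \<open>short_refines\<close>;
      \<open>\<beta> x = \<alpha> x\<close> is ruled out by the colors, and
      \<open>\<beta> x = x\<close> gives the claim directly.\<close>
    have ret: "\<beta> (\<alpha> (\<alpha> x)) = x"
      if "\<alpha> (\<alpha> (\<alpha> x)) = x" "f (\<alpha> (\<alpha> x)) = f x" "\<beta> x = \<alpha> (\<alpha> x)" "f (\<alpha> x) \<noteq> f x" for x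
    proof -
      have "\<beta> x = x \<or> \<beta> x = \<alpha> x \<or> \<beta> (\<beta> x) = x"
        using H unfolding short_refines_def by blast
      then show ?thesis using that by metis
    qed
    show "short_refines \<beta> g"
      using H eq[OF _ ret] unfolding short_refines_def by blast
  qed
qed

text \<open>The two tests in \<open>first_return\<close> run through all other points of the cycle.
  This turns properness into an equation that a Moebius sum can detect.\<close>

lemma first_return_eq_id_iff:
  assumes "cycles_le_3 \<alpha>"
  shows "first_return \<alpha> f = id \<longleftrightarrow> (\<forall>x. \<forall>y\<in>Orbits.orbit \<alpha> x. f y = f x \<longrightarrow> y = x)"
proof -
  have "first_return \<alpha> f x = x \<longleftrightarrow> (\<forall>y\<in>Orbits.orbit \<alpha> x. f y = f x \<longrightarrow> y = x)" for x
    by (auto simp: orbit_cycles_le_3[OF assms] first_return_def)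
  then show ?thesis by (simp add: fun_eq_iff)
qed

section \<open>Moebius sums over intervals\<close>

text \<open>For \<open>x \<noteq> y\<close> this is the defining recursion with the term at
  \<open>y\<close> moved across. For \<open>x = y\<close> the interval is a single point, since a
  well-founded strict part contains no pair in both directions.\<close>

lemma sum_mobius_interval:
  assumes wf: "wf (r - Id)" and xy: "(x, y) \<in> r" and yy: "(y, y) \<in> r"
    and fin: "finite {w. (x, w) \<in> r \<and> (w, y) \<in> r}"
  shows "(\<Sum>w | (x, w) \<in> r \<and> (w, y) \<in> r. mobius r x w) = (if y = x then 1 else 0)"
proof (cases "x = y")
  case True
  have "{w. (x, w) \<in> r \<and> (w, y) \<in> r} = {x}"
    using True yy wf_not_sym[OF wf] by auto
  then show ?thesis using True wf yy by (simp add: mobius.simps[of r y y])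
next
  case False
  have "{w. (x, w) \<in> r \<and> (w, y) \<in> r} - {y} = {w. (x, w) \<in> r \<and> (w, y) \<in> r \<and> w \<noteq> y}" by auto
  then have "(\<Sum>w | (x, w) \<in> r \<and> (w, y) \<in> r. mobius r x w)
      = mobius r x y + (\<Sum>w | (x, w) \<in> r \<and> (w, y) \<in> r \<and> w \<noteq> y. mobius r x w)"
    using sum.remove[OF fin, of y "mobius r x"] xy yy by simp
  then show ?thesis using False wf xy by (simp add: mobius.simps[of r x y])
qed

section \<open>Vertex colorings as point colorings\<close>

lemma orbit_eq_iff_perm:
  assumes "permutation \<sigma>"
  shows "Orbits.orbit \<sigma> x = Orbits.orbit \<sigma> y \<longleftrightarrow> y \<in> Orbits.orbit \<sigma> x"
  using permutation_self_in_orbit[OF assms, of y]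
    orbit_cyclic_eq3[OF cyclic_on_orbit'[OF assms, of x], of y] by auto

lemma constant_on_orbits_iff:
  assumes s: "\<sigma> permutes S" "finite S"
  shows "(\<forall>x\<in>S. \<forall>y\<in>S. Orbits.orbit \<sigma> x = Orbits.orbit \<sigma> y \<longrightarrow> f x = f y)
    \<longleftrightarrow> (\<forall>x\<in>S. f (\<sigma> x) = f x)"
proof -
  have perm: "permutation \<sigma>" using s by (auto simp: permutation_permutes)
  have "f y = f x \<and> y \<in> S"
    if inv: "\<forall>x\<in>S. f (\<sigma> x) = f x" and x: "x \<in> S" and y: "y \<in> Orbits.orbit \<sigma> x" for x y
    using y by induction (use inv x permutes_in_image[OF s(1)] in auto)
  moreover have "Orbits.orbit \<sigma> (\<sigma> x) = Orbits.orbit \<sigma> x" for x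
    by (rule permutation_orbit_step[OF perm])
  ultimately show ?thesis
    using permutes_in_image[OF s(1)] unfolding orbit_eq_iff_perm[OF perm]
    by (metis Orbits.orbit.base)
qed

text \<open>Comparison of two-colorings: \<open>\<beta>\<close> moves points along
  \<open>\<alpha>\<close>, so colorings invariant under \<open>\<alpha>\<close> are invariant under
  \<open>\<beta>\<close>, and powers of 2 order their exponents. This keeps the natural subtraction
  in \<open>characteristic_poly\<close> from truncating.\<close>

lemma kappa_antimono:
  assumes s: "\<sigma> permutes {1..n}" and a: "\<alpha> permutes {1..n}" and b: "\<beta> permutes {1..n}"
    and le: "short_refines \<beta> \<alpha>"
  shows "kappa n \<sigma> \<alpha> \<le> kappa n \<sigma> \<beta>"
proof -
  let ?inv = "\<lambda>\<beta>. {f \<in> {1..n} \<rightarrow>\<^sub>E {1..2::nat}. \<forall>x\<in>{1..n}. f (\<sigma> x) = f x \<and> f (\<beta> x) = f x}"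
  have "?inv \<alpha> \<subseteq> ?inv \<beta>"
  proof safe
    fix f :: "nat \<Rightarrow> nat" and x
    assume f: "\<forall>x\<in>{1..n}. f (\<sigma> x) = f x \<and> f (\<alpha> x) = f x" and x: "x \<in> {1..n}"
    have "f (\<alpha> x) = f x" "f (\<alpha> (\<alpha> x)) = f (\<alpha> x)"
      using f x permutes_in_image[OF a] by blast+
    moreover have "\<beta> x = x \<or> \<beta> x = \<alpha> x \<or> \<beta> x = \<alpha> (\<alpha> x)"
      using le unfolding short_refines_def by blast
    ultimately show "f (\<beta> x) = f x" by auto
  qed auto
  moreover have "finite (?inv \<beta>)"
    by (rule finite_subset[OF _ finite_PiE[of "{1..n}" "\<lambda>_. {1..2}"]]) auto
  ultimately have "card (?inv \<alpha>) \<le> card (?inv \<beta>)" by (rule card_mono[rotated])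
  then have "(2::nat) ^ kappa n \<sigma> \<alpha> \<le> 2 ^ kappa n \<sigma> \<beta>"
    unfolding card_invariant_colorings[OF s a] card_invariant_colorings[OF s b] .
  then show ?thesis by simp
qed

text \<open>Giving each point the color of its vertex is a bijection onto the point colorings
  invariant under \<open>\<sigma>\<close>, and it turns properness into
  \<open>first_return \<alpha> f = id\<close>.\<close>

lemma card_proper_colorings:
  assumes s: "\<sigma> permutes {1..n}" and a: "\<alpha> permutes {1..n}" and le3: "cycles_le_3 \<alpha>"
  shows "card (proper_colorings n \<sigma> \<alpha> m) =
    card {f \<in> {1..n} \<rightarrow>\<^sub>E {1..m}. (\<forall>x\<in>{1..n}. f (\<sigma> x) = f x) \<and> first_return \<alpha> f = id}"
proof -
  let ?S = "{1..n}" and ?h = "\<lambda>c. \<lambda>x\<in>{1..n}. c (Orbits.orbit \<sigma> x)"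
  have orb_S: "y \<in> ?S" if "y \<in> Orbits.orbit \<alpha> x" "x \<in> ?S" for x y
    using permutes_orbit_subset[OF a that(2)] that(1) by blast
  have proper: "first_return \<alpha> (?h c) = id \<longleftrightarrow>
      (\<forall>C\<in>cycles \<alpha> ?S. \<forall>x\<in>C. \<forall>y\<in>C. x \<noteq> y \<longrightarrow>
        c (Orbits.orbit \<sigma> x) \<noteq> c (Orbits.orbit \<sigma> y))"
    for c :: "nat set \<Rightarrow> nat"
  proof -
    \<comment> \<open>Outside \<open>?S\<close> the coloring \<open>?h c\<close> is
      \<open>undefined\<close>; this is harmless because \<open>\<alpha>\<close> fixes these points
      and their orbits are singletons.\<close>
    have outside: "y = x" if "x \<notin> ?S" "y \<in> Orbits.orbit \<alpha> x" for x y
      using that(2) permutes_not_in[OF a that(1)] by (simp add: orbit_cycles_le_3[OF le3])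
    have eq: "(?h c y = ?h c x \<longrightarrow> y = x) \<longleftrightarrow>
        (x \<noteq> y \<longrightarrow> c (Orbits.orbit \<sigma> x) \<noteq> c (Orbits.orbit \<sigma> y))"
      if "x \<in> ?S" "y \<in> Orbits.orbit \<alpha> x" for x y
    proof -
      have h: "?h c x = c (Orbits.orbit \<sigma> x)" "?h c y = c (Orbits.orbit \<sigma> y)"
        using that(1) orb_S[OF that(2,1)] by (simp_all only: restrict_apply if_True)
      show ?thesis unfolding h by metis
    qed
    have "first_return \<alpha> (?h c) = id \<longleftrightarrow>
        (\<forall>x\<in>?S. \<forall>y\<in>Orbits.orbit \<alpha> x. ?h c y = ?h c x \<longrightarrow> y = x)"
      unfolding first_return_eq_id_iff[OF le3]
      using outside by blast
    also have "\<dots> \<longleftrightarrow> (\<forall>x\<in>?S. \<forall>y\<in>Orbits.orbit \<alpha> x. x \<noteq> y \<longrightarrow>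
        c (Orbits.orbit \<sigma> x) \<noteq> c (Orbits.orbit \<sigma> y))"
      by (intro ball_cong refl eq)
    also have "\<dots> \<longleftrightarrow> (\<forall>C\<in>cycles \<alpha> ?S. \<forall>x\<in>C. \<forall>y\<in>C. x \<noteq> y \<longrightarrow>
        c (Orbits.orbit \<sigma> x) \<noteq> c (Orbits.orbit \<sigma> y))"
    proof (intro iffI ballI)
      fix C x y
      assume all: "\<forall>x\<in>?S. \<forall>y\<in>Orbits.orbit \<alpha> x. x \<noteq> y \<longrightarrow>
          c (Orbits.orbit \<sigma> x) \<noteq> c (Orbits.orbit \<sigma> y)"
        and C: "C \<in> cycles \<alpha> ?S" "x \<in> C" "y \<in> C"
      have "x \<in> ?S" "y \<in> Orbits.orbit \<alpha> x"
        using cycles_perm(1,5)[OF a finite_atLeastAtMost C(1)] C(2,3) by auto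
      then show "x \<noteq> y \<longrightarrow> c (Orbits.orbit \<sigma> x) \<noteq> c (Orbits.orbit \<sigma> y)" using all by blast
    next
      fix x y
      assume all: "\<forall>C\<in>cycles \<alpha> ?S. \<forall>x\<in>C. \<forall>y\<in>C. x \<noteq> y \<longrightarrow>
          c (Orbits.orbit \<sigma> x) \<noteq> c (Orbits.orbit \<sigma> y)"
        and xy: "x \<in> ?S" "y \<in> Orbits.orbit \<alpha> x"
      have "Orbits.orbit \<alpha> x \<in> cycles \<alpha> ?S" "x \<in> Orbits.orbit \<alpha> x"
        using xy(1) by (simp_all add: cycles_def orbit_cycles_le_3[OF le3])
      then show "x \<noteq> y \<longrightarrow> c (Orbits.orbit \<sigma> x) \<noteq> c (Orbits.orbit \<sigma> y)"
        using all xy(2) by blast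
    qed
    finally show ?thesis .
  qed
  have "bij_betw ?h (cycles \<sigma> ?S \<rightarrow>\<^sub>E {1..m})
      {f \<in> ?S \<rightarrow>\<^sub>E {1..m}. \<forall>x\<in>?S. f (\<sigma> x) = f x}"
    using bij_betw_constant_on_fibres[where q = "Orbits.orbit \<sigma>" and S = ?S and M = "{1..m}"]
    unfolding constant_on_orbits_iff[OF s finite_atLeastAtMost] cycles_def .
  then have "bij_betw ?h (proper_colorings n \<sigma> \<alpha> m)
      {f \<in> {f \<in> ?S \<rightarrow>\<^sub>E {1..m}. \<forall>x\<in>?S. f (\<sigma> x) = f x}. first_return \<alpha> f = id}"
    unfolding proper_colorings_def by (rule bij_betw_Collect) (rule proper)
  then show ?thesis by (simp add: bij_betw_same_card conj_assoc)
qed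

section \<open>Exchanging the sums over refinements and colorings\<close>

theorem theorem6p11:
  fixes n m :: nat and \<sigma> \<alpha> :: "nat \<Rightarrow> nat"
  assumes "\<sigma> permutes {1..n}" and "\<alpha> permutes {1..n}"
    and "\<And>C. C \<in> cycles \<alpha> {1..n} \<Longrightarrow> card C \<le> 3"
    and "m > 0"
  shows "int m ^ kappa n \<sigma> \<alpha> * poly (characteristic_poly n \<sigma> \<alpha>) (int m)
           = int (card (proper_colorings n \<sigma> \<alpha> m))"
proof -
  note s = assms(1) and a = assms(2)
  let ?S = "{1..n}" and ?r = "refinement_order n"
  let ?\<mu> = "mobius ?r id" and ?B = "{\<beta>. refines n \<beta> \<alpha>}"
  \<comment> \<open>The index set of the colorings must not depend on \<open>\<beta>\<close>, so
    only invariance under \<open>\<sigma>\<close> is built in; extensionality makes it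
    finite.\<close>
  define F where "F = {f \<in> ?S \<rightarrow>\<^sub>E {1..m}. \<forall>x\<in>?S. f (\<sigma> x) = f x}"
  have le3: "cycles_le_3 \<alpha>" by (rule cycles_le_3I[OF a finite_atLeastAtMost assms(3)])
  note ref = refines_iff[OF a le3]
  have finB: "finite ?B"
    by (rule finite_subset[OF _ finite_permutations[of ?S]]) (auto simp: ref)
  have finF: "finite F"
    unfolding F_def by (rule finite_subset[OF _ finite_PiE[of ?S "\<lambda>_. {1..m}"]]) auto

  \<comment> \<open>The range of summation is the interval from \<open>id\<close> to
    \<open>first_return \<alpha> f\<close>, so the Moebius sum collapses.\<close>
  have inner: "(\<Sum>\<beta> | \<beta> \<in> ?B \<and> (\<forall>x\<in>?S. f (\<beta> x) = f x). ?\<mu> \<beta>)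
      = (if first_return \<alpha> f = id then 1 else 0)" for f :: "nat \<Rightarrow> nat"
  proof -
    let ?g = "first_return \<alpha> f"
    have g: "?g permutes ?S" by (rule first_return_permutes[OF a finite_atLeastAtMost le3])
    have ref_g: "refines n \<beta> ?g \<longleftrightarrow> \<beta> permutes ?S \<and> short_refines \<beta> ?g" for \<beta>
      by (rule refines_iff[OF g cycles_le_3_first_return[OF le3]])
    have id_le: "(id, \<beta>) \<in> ?r \<longleftrightarrow> \<beta> permutes ?S" for \<beta>
      using refines_id by (auto simp: refinement_order_def)
    have le_g: "(\<beta>, ?g) \<in> ?r \<longleftrightarrow> \<beta> permutes ?S \<and> short_refines \<beta> ?g" for \<beta>
      using g by (auto simp: refinement_order_def ref_g)
    have "refines n \<beta> \<alpha> \<and> (\<forall>x\<in>?S. f (\<beta> x) = f x) \<longleftrightarrow> (id, \<beta>) \<in> ?r \<and> (\<beta>, ?g) \<in> ?r" for \<beta>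
    proof (cases "\<beta> permutes ?S")
      case True
      \<comment> \<open>Points outside \<open>?S\<close> are fixed by \<open>\<beta>\<close>, so
        they preserve their color whatever \<open>f\<close> is there.\<close>
      then have "(\<forall>x\<in>?S. f (\<beta> x) = f x) \<longleftrightarrow> (\<forall>x. f (\<beta> x) = f x)"
        using permutes_not_in by metis
      then show ?thesis
        using True short_refines_first_return_iff[OF permutes_inj[OF True] le3, of f]
        by (simp add: ref id_le le_g)
    qed (simp add: ref id_le)
    moreover have "finite {\<beta>. (id, \<beta>) \<in> ?r \<and> (\<beta>, ?g) \<in> ?r}"
      by (rule finite_subset[OF _ finite_permutations[of ?S]]) (auto simp: id_le)
    then have "(\<Sum>\<beta> | (id, \<beta>) \<in> ?r \<and> (\<beta>, ?g) \<in> ?r. ?\<mu> \<beta>) = (if ?g = id then 1 else 0)"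
      using g by (intro sum_mobius_interval wf_refinement_order)
        (simp_all add: id_le le_g short_refines_def)
    ultimately show ?thesis by simp
  qed

  have "int m ^ kappa n \<sigma> \<alpha> * poly (characteristic_poly n \<sigma> \<alpha>) (int m)
      = (\<Sum>\<beta>\<in>?B. ?\<mu> \<beta> * int m ^ kappa n \<sigma> \<beta>)"
    unfolding characteristic_poly_def poly_sum sum_distrib_left
  proof (rule sum.cong[OF refl])
    fix \<beta> assume "\<beta> \<in> ?B"
    \<comment> \<open>Without truncation, the factor \<open>m ^ kappa n \<sigma> \<alpha>\<close>
      restores the full exponent \<open>kappa n \<sigma> \<beta>\<close>.\<close>
    then have "kappa n \<sigma> \<alpha> \<le> kappa n \<sigma> \<beta>"
      using kappa_antimono[OF s a] by (simp add: ref)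
    then have "int m ^ kappa n \<sigma> \<beta> = int m ^ kappa n \<sigma> \<alpha> * int m ^ (kappa n \<sigma> \<beta> - kappa n \<sigma> \<alpha>)"
      by (simp flip: power_add)
    then show "int m ^ kappa n \<sigma> \<alpha> * poly (monom (?\<mu> \<beta>) (kappa n \<sigma> \<beta> - kappa n \<sigma> \<alpha>)) (int m)
        = ?\<mu> \<beta> * int m ^ kappa n \<sigma> \<beta>"
      by (simp add: poly_monom)
  qed
  \<comment> \<open>Each power is the number of colorings in \<open>F\<close> preserved by
    \<open>\<beta>\<close>, so the term becomes a constant sum over them.\<close>
  also have "\<dots> = (\<Sum>\<beta>\<in>?B. \<Sum>f | f \<in> F \<and> (\<forall>x\<in>?S. f (\<beta> x) = f x). ?\<mu> \<beta>)"
  proof (rule sum.cong[OF refl])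
    fix \<beta> assume "\<beta> \<in> ?B"
    then have b: "\<beta> permutes ?S" by (simp add: ref)
    have "{f \<in> F. \<forall>x\<in>?S. f (\<beta> x) = f x}
        = {f \<in> ?S \<rightarrow>\<^sub>E {1..m}. \<forall>x\<in>?S. f (\<sigma> x) = f x \<and> f (\<beta> x) = f x}"
      by (auto simp: F_def)
    then have "card {f \<in> F. \<forall>x\<in>?S. f (\<beta> x) = f x} = m ^ kappa n \<sigma> \<beta>"
      using card_invariant_colorings[OF s b] by simp
    then show "?\<mu> \<beta> * int m ^ kappa n \<sigma> \<beta>
        = (\<Sum>f | f \<in> F \<and> (\<forall>x\<in>?S. f (\<beta> x) = f x). ?\<mu> \<beta>)"
      by simp
  qed
  also have "\<dots> = (\<Sum>f\<in>F. \<Sum>\<beta> | \<beta> \<in> ?B \<and> (\<forall>x\<in>?S. f (\<beta> x) = f x). ?\<mu> \<beta>)"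
    by (rule sum.swap_restrict[OF finB finF])
  also have "\<dots> = (\<Sum>f\<in>F. if first_return \<alpha> f = id then 1 else 0)"
    by (rule sum.cong[OF refl inner])
  also have "\<dots> = int (card {f \<in> F. first_return \<alpha> f = id})"
    using finF by (simp flip: sum.inter_filter)
  also have "{f \<in> F. first_return \<alpha> f = id}
      = {f \<in> ?S \<rightarrow>\<^sub>E {1..m}. (\<forall>x\<in>?S. f (\<sigma> x) = f x) \<and> first_return \<alpha> f = id}"
    by (auto simp: F_def)
  finally show ?thesis by (simp add: card_proper_colorings[OF s a le3])
qed

end
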